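(* Let $G=(V,E)$ be a simple, nontrivial (at least two vertices), connected graph. Then $\gamma_{V,E}(G)\ge\gamma'(G)$, $\gamma_{V,E}(G)\ge\gamma''(G)$, $\gamma_{V,E}(G)\ge\gamma(G)$, $\gamma_{E,V}(G)\ge\gamma'(G)$, $\gamma_{E,V}(G)\ge\gamma''(G)$, $\gamma_{E,V}(G)\ge\gamma(G)$, $\gamma''(G)\ge\gamma'(G)$, and $\gamma''(G)\ge\gamma(G)$.
   Context: An element of a graph $G=(V,E)$ is a member of $V\cup E$. Two different elements are associated if they are adjacent (two adjacent vertices, or two edges sharing an end-vertex) or incident (a vertex and an edge containing it). For $U,W\in\{V,E,V\cup E\}$, a subset $A\subseteq U$ dominates $W$ if every element of $W\setminus(A\cap W)$ is associated with some element of $A$; $\gamma_{U,W}(G)$ denotes the minimum cardinality of a subset $A\subseteq U$ dominating $W$. Notation: $\gamma(G)=\gamma_{V,V}(G)$, $\gamma'(G)=\gamma_{E,E}(G)$, $\gamma''(G)=\gamma_{V\cup E,V\cup E}(G)$. *)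

theory Defs
  imports Main "HOL-Library.Extended_Nat"
begin

definition simple_graph :: "'a set \<Rightarrow> 'a set set \<Rightarrow> bool" where
  "simple_graph V E \<longleftrightarrow> (\<forall>e\<in>E. e \<subseteq> V \<and> card e = 2)"

definition connected_graph :: "'a set \<Rightarrow> 'a set set \<Rightarrow> bool" where
  "connected_graph V E \<longleftrightarrow> (\<forall>u\<in>V. \<forall>v\<in>V. (u, v) \<in> {(x, y). {x, y} \<in> E}\<^sup>*)"

definition ecard :: "'b set \<Rightarrow> enat" where
  "ecard A = (if finite A then enat (card A) else \<infinity>)"

datatype 'a element = Vert 'a | Edge "'a set"

definition verts :: "'a set \<Rightarrow> 'a element set" where
  "verts V = Vert ` V"

definition edges :: "'a set set \<Rightarrow> 'a element set" where
  "edges E = Edge ` E"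

fun associated :: "'a set set \<Rightarrow> 'a element \<Rightarrow> 'a element \<Rightarrow> bool" where
  "associated E (Vert u) (Vert v) \<longleftrightarrow> u \<noteq> v \<and> {u, v} \<in> E"
| "associated E (Edge e) (Edge f) \<longleftrightarrow> e \<noteq> f \<and> e \<inter> f \<noteq> {}"
| "associated E (Vert v) (Edge e) \<longleftrightarrow> v \<in> e"
| "associated E (Edge e) (Vert v) \<longleftrightarrow> v \<in> e"

definition dominates :: "'a set set \<Rightarrow> 'a element set \<Rightarrow> 'a element set \<Rightarrow> bool" where
  "dominates E A W \<longleftrightarrow> (\<forall>x \<in> W - (A \<inter> W). \<exists>a\<in>A. associated E x a)"

text \<open>
  \<^typ>\<open>enat\<close> is well-ordered, so the infimum of a nonempty set is its minimum; the infimum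
  of the empty set is \<open>\<infinity>\<close>, so a missing dominating set never yields a small value.
\<close>

definition dom_number :: "'a set set \<Rightarrow> 'a element set \<Rightarrow> 'a element set \<Rightarrow> enat" where
  "dom_number E U W = (INF A \<in> {A. A \<subseteq> U \<and> dominates E A W}. ecard A)"

definition gamma_VE :: "'a set \<Rightarrow> 'a set set \<Rightarrow> enat" where
  "gamma_VE V E = dom_number E (verts V) (edges E)"

definition gamma_EV :: "'a set \<Rightarrow> 'a set set \<Rightarrow> enat" where
  "gamma_EV V E = dom_number E (edges E) (verts V)"

definition gamma_VV :: "'a set \<Rightarrow> 'a set set \<Rightarrow> enat" where
  "gamma_VV V E = dom_number E (verts V) (verts V)"

definition gamma_EE :: "'a set \<Rightarrow> 'a set set \<Rightarrow> enat" where
  "gamma_EE V E = dom_number E (edges E) (edges E)"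

definition gamma_total :: "'a set \<Rightarrow> 'a set set \<Rightarrow> enat" where
  "gamma_total V E = dom_number E (verts V \<union> edges E) (verts V \<union> edges E)"

end

theory Submission imports Defs begin

text \<open>
  Every vertex lies on an edge, so a vertex set meeting all edges, and likewise an edge set covering
  all vertices, dominates all elements. This gives the bounds over \<open>\<gamma>''\<close>. Conversely, given a set
  dominating all elements, replacing each of its vertices by an incident edge yields an edge set
  dominating \<open>E\<close>, and replacing each of its edges by an end-vertex yields a vertex set dominating \<open>V\<close>;
  neither replacement increases the cardinality. The other inequalities follow by transitivity.
\<close>

lemma ecard_image_le: "ecard (f ` A) \<le> ecard A"
  by (auto simp: ecard_def card_image_le)

lemma dom_number_le_if_image_dominates:
  assumes "\<And>A. A \<subseteq> U \<Longrightarrow> dominates E A W \<Longrightarrow> f ` A \<subseteq> U' \<and> dominates E (f ` A) W'"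
  shows "dom_number E U' W' \<le> dom_number E U W"
  unfolding dom_number_def
proof (rule INF_greatest)
  fix A assume "A \<in> {A. A \<subseteq> U \<and> dominates E A W}"
  then have "f ` A \<in> {A. A \<subseteq> U' \<and> dominates E A W'}"
    using assms by blast
  then have "(INF A \<in> {A. A \<subseteq> U' \<and> dominates E A W'}. ecard A) \<le> ecard (f ` A)"
    by (rule INF_lower)
  then show "(INF A \<in> {A. A \<subseteq> U' \<and> dominates E A W'}. ecard A) \<le> ecard A"
    using ecard_image_le order_trans by blast
qed

lemma dom_number_mono:
  assumes "U \<subseteq> U'" and "\<And>A. A \<subseteq> U \<Longrightarrow> dominates E A W \<Longrightarrow> dominates E A W'"
  shows "dom_number E U' W' \<le> dom_number E U W"
  using assms by (intro dom_number_le_if_image_dominates[where f = id]) auto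

lemma simple_graph_edgeE:
  assumes "simple_graph V E" "e \<in> E"
  obtains u v where "e = {u, v}" "u \<noteq> v" "u \<in> V" "v \<in> V"
  using assms by (force simp: simple_graph_def card_2_iff)

text \<open>The first step of a path from \<open>v\<close> to some other vertex is an edge at
  \<open>v\<close>; it is not a loop because every edge has two elements.\<close>

lemma connected_graph_incident_edge:
  assumes "simple_graph V E" "ecard V \<ge> 2" "connected_graph V E" "v \<in> V"
  obtains w where "{v, w} \<in> E" "w \<noteq> v" "w \<in> V"
proof -
  have "V \<noteq> {v}"
    using assms(2) by (auto simp: ecard_def numeral_eq_enat)
  then obtain u where "u \<in> V" "u \<noteq> v"
    using assms(4) by blast
  then have "(v, u) \<in> {(x, y). {x, y} \<in> E}\<^sup>*"
    using assms by (auto simp: connected_graph_def)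
  then obtain w where w: "{v, w} \<in> E"
    using \<open>u \<noteq> v\<close> by (auto elim: converse_rtranclE)
  then obtain a b where "{v, w} = {a, b}" "a \<noteq> b" "a \<in> V" "b \<in> V"
    using simple_graph_edgeE[OF assms(1)] by metis
  then have "w \<noteq> v" "w \<in> V"
    by (auto simp: doubleton_eq_iff)
  with w show thesis by (rule that)
qed

text \<open>Only vertices outside \<open>A\<close> remain to be checked. An edge at such a vertex
  \<open>v\<close> must have an end-vertex in \<open>A\<close>, and this can only be the other end,
  a neighbour of \<open>v\<close>.\<close>

lemma dominates_total_if_vertices_dominate_edges:
  assumes "simple_graph V E" "ecard V \<ge> 2" "connected_graph V E"
    and "A \<subseteq> verts V" "dominates E A (edges E)"
  shows "dominates E A (verts V \<union> edges E)"
proof -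
  have "\<exists>a\<in>A. associated E (Vert v) a" if v: "v \<in> V" "Vert v \<notin> A" for v
  proof -
    obtain w where w: "{v, w} \<in> E" "w \<noteq> v"
      using connected_graph_incident_edge[OF assms(1-3) v(1)] by metis
    then have "Edge {v, w} \<in> edges E - (A \<inter> edges E)"
      using assms(4) by (auto simp: edges_def verts_def)
    then obtain a where a: "a \<in> A" "associated E (Edge {v, w}) a"
      using assms(5) unfolding dominates_def by blast
    then have "a = Vert w"
      using assms(4) v(2) a by (auto simp: verts_def)
    with a w show ?thesis by force
  qed
  then show ?thesis
    using assms(5) by (auto simp: dominates_def verts_def)
qed

text \<open>An end-vertex \<open>v\<close> of an edge \<open>e\<close> outside \<open>A\<close> lies
  on some edge of \<open>A\<close>; that edge differs from \<open>e\<close> and meets it in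
  \<open>v\<close>.\<close>

lemma dominates_total_if_edges_dominate_vertices:
  assumes "simple_graph V E"
    and "A \<subseteq> edges E" "dominates E A (verts V)"
  shows "dominates E A (verts V \<union> edges E)"
proof -
  have "\<exists>a\<in>A. associated E (Edge e) a" if e: "e \<in> E" "Edge e \<notin> A" for e
  proof -
    obtain v where v: "v \<in> e" "v \<in> V"
      using simple_graph_edgeE[OF assms(1) e(1)] by blast
    then have "Vert v \<in> verts V - (A \<inter> verts V)"
      using assms(2) by (auto simp: edges_def verts_def)
    then obtain a where a: "a \<in> A" "associated E (Vert v) a"
      using assms(3) unfolding dominates_def by blast
    then obtain f where "a = Edge f" "v \<in> f"
      using assms(2) by (auto simp: edges_def)
    with a v e show ?thesis by force
  qed
  then show ?thesis
    using assms(3) by (auto simp: dominates_def edges_def)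
qed

lemma gamma_total_le_gamma_VE:
  assumes "simple_graph V E" "ecard V \<ge> 2" "connected_graph V E"
  shows "gamma_total V E \<le> gamma_VE V E"
  unfolding gamma_total_def gamma_VE_def
  using dominates_total_if_vertices_dominate_edges[OF assms] by (intro dom_number_mono) auto

lemma gamma_total_le_gamma_EV:
  assumes "simple_graph V E"
  shows "gamma_total V E \<le> gamma_EV V E"
  unfolding gamma_total_def gamma_EV_def
  using dominates_total_if_edges_dominate_vertices[OF assms] by (intro dom_number_mono) auto

lemma gamma_EE_le_gamma_total:
  assumes "simple_graph V E" "ecard V \<ge> 2" "connected_graph V E"
  shows "gamma_EE V E \<le> gamma_total V E"
proof -
  have "\<exists>g. \<forall>v\<in>V. g v \<in> E \<and> v \<in> g v"
    using connected_graph_incident_edge[OF assms] by (intro bchoice) (metis insertI1)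
  then obtain g where g: "\<And>v. v \<in> V \<Longrightarrow> g v \<in> E" "\<And>v. v \<in> V \<Longrightarrow> v \<in> g v"
    by blast
  \<comment> \<open>Edges stay fixed, and a vertex \<open>v\<close> moves to a chosen edge through
    \<open>v\<close>, which meets every edge that contains \<open>v\<close>.\<close>
  define f where "f = case_element (\<lambda>v. Edge (g v)) Edge"
  show ?thesis
    unfolding gamma_EE_def gamma_total_def
  proof (rule dom_number_le_if_image_dominates[where f = f], intro conjI)
    fix A assume A: "A \<subseteq> verts V \<union> edges E" "dominates E A (verts V \<union> edges E)"
    show "f ` A \<subseteq> edges E"
      using A(1) g(1) by (force simp: f_def verts_def edges_def)
    show "dominates E (f ` A) (edges E)"
      unfolding dominates_def
    proof
      fix x assume x: "x \<in> edges E - (f ` A \<inter> edges E)"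
      then obtain e where e: "x = Edge e" "e \<in> E"
        by (auto simp: edges_def)
      have "Edge e \<notin> A"
        using x e by (force simp: f_def)
      then obtain a where a: "a \<in> A" "associated E x a"
        using A(2) x e(1) unfolding dominates_def by blast
      \<comment> \<open>Two edges are associated only if they are distinct, so the replacement must
        not be \<open>x\<close> itself; otherwise \<open>x\<close> would lie in the image.\<close>
      have "f a \<noteq> x"
        using x a(1) by blast
      then have "associated E x (f a)"
        using a A(1) g(2) e(1) by (cases a) (auto simp: f_def verts_def edges_def)
      then show "\<exists>b\<in>f ` A. associated E x b"
        using a(1) by blast
    qed
  qed
qed

lemma gamma_VV_le_gamma_total:
  assumes "simple_graph V E"
  shows "gamma_VV V E \<le> gamma_total V E"
proof -
  have "\<exists>g. \<forall>e\<in>E. g e \<in> V \<and> g e \<in> e"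
    using simple_graph_edgeE[OF assms] by (intro bchoice) (metis insertI1)
  then obtain g where g: "\<And>e. e \<in> E \<Longrightarrow> g e \<in> V" "\<And>e. e \<in> E \<Longrightarrow> g e \<in> e"
    by blast
  \<comment> \<open>Vertices stay fixed, and an edge moves to a chosen end-vertex. If the edge
    contains \<open>v\<close>, that end-vertex is \<open>v\<close> itself or a neighbour of
    \<open>v\<close>.\<close>
  define f where "f = case_element Vert (\<lambda>e. Vert (g e))"
  show ?thesis
    unfolding gamma_VV_def gamma_total_def
  proof (rule dom_number_le_if_image_dominates[where f = f], intro conjI)
    fix A assume A: "A \<subseteq> verts V \<union> edges E" "dominates E A (verts V \<union> edges E)"
    show "f ` A \<subseteq> verts V"
      using A(1) g(1) by (force simp: f_def verts_def edges_def)
    show "dominates E (f ` A) (verts V)"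
      unfolding dominates_def
    proof
      fix x assume x: "x \<in> verts V - (f ` A \<inter> verts V)"
      then obtain v where v: "x = Vert v"
        by (auto simp: verts_def)
      have "Vert v \<notin> A"
        using x v by (force simp: f_def)
      then obtain a where a: "a \<in> A" "associated E x a"
        using A(2) x v unfolding dominates_def by blast
      have neq: "f a \<noteq> x"
        using x a(1) by blast
      have "associated E x (f a)"
      proof (cases a)
        case (Vert u)
        then show ?thesis using a(2) by (simp add: f_def)
      next
        case (Edge e)
        then have e: "e \<in> E" "v \<in> e" "g e \<noteq> v"
          using a A(1) v neq by (auto simp: f_def verts_def edges_def)
        obtain p q where "e = {p, q}"
          using simple_graph_edgeE[OF assms e(1)] by blast
        \<comment> \<open>Both \<open>v\<close> and \<open>g e\<close> lie in the two-element set
          \<open>e\<close> and they differ, so they exhaust it; hence \<open>e\<close> itself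
          witnesses that they are adjacent.\<close>
        then have "{v, g e} = e"
          using e(2,3) g(2)[OF e(1)] by auto
        then show ?thesis
          using e(1,3) Edge v by (simp add: f_def)
      qed
      then show "\<exists>b\<in>f ` A. associated E x b"
        using a(1) by blast
    qed
  qed
qed

theorem theorem2:
  fixes V :: "'a set" and E :: "'a set set"
  assumes "simple_graph V E"
    and "ecard V \<ge> 2"
    and "connected_graph V E"
  shows "gamma_VE V E \<ge> gamma_EE V E \<and> gamma_VE V E \<ge> gamma_total V E \<and> gamma_VE V E \<ge> gamma_VV V E \<and>
         gamma_EV V E \<ge> gamma_EE V E \<and> gamma_EV V E \<ge> gamma_total V E \<and> gamma_EV V E \<ge> gamma_VV V E \<and>
         gamma_total V E \<ge> gamma_EE V E \<and> gamma_total V E \<ge> gamma_VV V E"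
  using gamma_total_le_gamma_VE[OF assms] gamma_total_le_gamma_EV[OF assms(1)]
    gamma_EE_le_gamma_total[OF assms] gamma_VV_le_gamma_total[OF assms(1)]
  by (meson order_trans)

end
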